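(* Let $\mathbf X\in\mathbb R^{n\times d}$ and $\lambda\ge 0$, where in the case $\lambda=0$ the matrix $\mathbf X$ is assumed to have rank $d$. Let $d_\lambda=\operatorname{tr}\big(\mathbf X(\mathbf X^\top\mathbf X+\lambda\mathbf I)^{-1}\mathbf X^\top\big)$, and let $s\in\{0,\dots,n\}$ be any integer with $s\ge d_\lambda$. If $S$ is sampled according to $\lambda$-regularized size $s$ volume sampling from $\mathbf X$, then $$\mathbb E\big[(\mathbf X_S^\top\mathbf X_S+\lambda\mathbf I)^{-1}\big]\preceq\frac{n-d_\lambda+1}{s-d_\lambda+1}\,(\mathbf X^\top\mathbf X+\lambda\mathbf I)^{-1}.$$
   Context: $\mathbf X_S$ is the submatrix of the rows of $\mathbf X$ indexed by $S$; $\mathbf I$ is the $d\times d$ identity. $\lambda$-regularized size $s$ volume sampling from $\mathbf X$ is the following random procedure: start with $S=\{1,\dots,n\}$; while $|S|>s$, pick $i\in S$ with probability proportional to $$h_i=\frac{\det(\mathbf X_{S\setminus\{i\}}^\top\mathbf X_{S\setminus\{i\}}+\lambda\mathbf I)}{\det(\mathbf X_S^\top\mathbf X_S+\lambda\mathbf I)}$$ and replace $S$ by $S\setminus\{i\}$; return $S$. $\mathbf A\preceq\mathbf B$ means that $\mathbf B-\mathbf A$ is positive semidefinite. The expectation is over the sets $S$ returned with positive probability. *)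

theory Defs
  imports
    "HOL-Probability.Probability_Mass_Function"
    "Jordan_Normal_Form.Determinant"
    "Jordan_Normal_Form.Gauss_Jordan_Elimination"
    "Jordan_Normal_Form.DL_Rank"
    "Jordan_Normal_Form.DL_Submatrix"
begin

(* HOL-Analysis also has constants mat, det, trace and rank; the qualified names below pick the
   ones for matrices with explicit dimensions. Rows are numbered 0, ..., n - 1. *)

(* Unspecified on singular matrices. *)
definition mat_inv :: "real Matrix.mat \<Rightarrow> real Matrix.mat" where
  "mat_inv A = the (mat_inverse A)"

definition mat_trace :: "real Matrix.mat \<Rightarrow> real" where
  "mat_trace A = (\<Sum>i<dim_row A. A $$ (i, i))"

definition psd :: "real Matrix.mat \<Rightarrow> bool" where
  "psd A \<longleftrightarrow> dim_col A = dim_row A \<and> transpose_mat A = A \<and>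
     (\<forall>v \<in> carrier_vec (dim_row A). 0 \<le> scalar_prod v (A *\<^sub>v v))"

definition loewner_le :: "real Matrix.mat \<Rightarrow> real Matrix.mat \<Rightarrow> bool" (infix \<open>\<preceq>\<close> 50) where
  "A \<preceq> B \<longleftrightarrow> dim_row A = dim_row B \<and> dim_col A = dim_col B \<and> psd (B - A)"

definition row_submatrix :: "real Matrix.mat \<Rightarrow> nat set \<Rightarrow> real Matrix.mat" where
  "row_submatrix X S = submatrix X S UNIV"

definition reg_gram :: "real Matrix.mat \<Rightarrow> real \<Rightarrow> real Matrix.mat" where
  "reg_gram X l = transpose_mat X * X + l \<cdot>\<^sub>m 1\<^sub>m (dim_col X)"

definition eff_dim :: "real Matrix.mat \<Rightarrow> real \<Rightarrow> real" where
  "eff_dim X l = mat_trace (X * mat_inv (reg_gram X l) * transpose_mat X)"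

definition removal_weight :: "real Matrix.mat \<Rightarrow> real \<Rightarrow> nat set \<Rightarrow> nat \<Rightarrow> real" where
  "removal_weight X l S i =
     Determinant.det (reg_gram (row_submatrix X (S - {i})) l) /
     Determinant.det (reg_gram (row_submatrix X S) l)"

(* embed_pmf is unspecified unless the normalised weights form a probability distribution, i.e.
   unless the sum of the weights (all nonnegative) is positive. The sum equals
   card S - eff_dim (row_submatrix X S) l whenever reg_gram (row_submatrix X S) l is invertible,
   and eff_dim (row_submatrix X S) l \<le> eff_dim X l, so it is positive for every set reached with
   positive probability at which the loop below still has to remove a row, if the target size is
   at least eff_dim X l. *)
definition removal_pmf :: "real Matrix.mat \<Rightarrow> real \<Rightarrow> nat set \<Rightarrow> nat pmf" where
  "removal_pmf X l S = embed_pmf (\<lambda>i. if i \<in> S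
     then removal_weight X l S i / (\<Sum>j\<in>S. removal_weight X l S j) else 0)"

primrec removal_rounds :: "real Matrix.mat \<Rightarrow> real \<Rightarrow> nat \<Rightarrow> nat set \<Rightarrow> nat set pmf" where
  "removal_rounds X l 0 S = return_pmf S"
| "removal_rounds X l (Suc k) S =
     bind_pmf (removal_pmf X l S) (\<lambda>i. removal_rounds X l k (S - {i}))"

(* Each round removes exactly one row, so the loop "while card S > s" makes exactly
   n - s rounds when s \<le> n. *)
definition volume_sampling :: "real Matrix.mat \<Rightarrow> real \<Rightarrow> nat \<Rightarrow> nat set pmf" where
  "volume_sampling X l s = removal_rounds X l (dim_row X - s) {..<dim_row X}"

(* Entrywise expectation of a d x d random matrix. *)
definition mat_expectation ::
    "nat \<Rightarrow> 'a pmf \<Rightarrow> ('a \<Rightarrow> real Matrix.mat) \<Rightarrow> real Matrix.mat" where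
  "mat_expectation d p M =
     Matrix.mat d d (\<lambda>(i, j). measure_pmf.expectation p (\<lambda>\<omega>. M \<omega> $$ (i, j)))"

end

theory Submission
  imports Defs
begin

text \<open>
  Fix a vector \<open>v\<close>, write \<open>A = X_S\<^sup>T X_S + l I\<close> for the current set \<open>S\<close>, and let
  \<open>q(S) = v\<^sup>T A\<^sup>-\<^sup>1 v\<close>. By the matrix determinant lemma the weight of row \<open>x\<close> is
  \<open>h = 1 - x\<^sup>T A\<^sup>-\<^sup>1 x\<close>, and by Sherman--Morrison removing it raises \<open>q\<close> by
  \<open>(x\<^sup>T A\<^sup>-\<^sup>1 v)\<^sup>2 / h\<close>. The factor \<open>h\<close> cancels against the removal probability \<open>h / H\<close>, where
  \<open>H = card S - eff_dim X_S\<close> is the sum of the weights, and \<open>\<Sum> (x\<^sup>T A\<^sup>-\<^sup>1 v)\<^sup>2 \<le> q(S)\<close>; so one round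
  multiplies \<open>q\<close> in expectation by at most \<open>1 + 1 / H\<close>. The effective dimension never grows along
  the run, because it is \<open>d - l tr A\<^sup>-\<^sup>1\<close>; hence \<open>H \<ge> card S - D\<close> with \<open>D\<close> the effective
  dimension of \<open>X\<close>, and the resulting factors \<open>(k - D + 1) / (k - D)\<close> for \<open>k = s + 1, \<dots>, n\<close>
  telescope.
\<close>

section \<open>Matrix inverses and symmetric matrices\<close>

lemma smult_mat_mult_vec:
  fixes A :: "real Matrix.mat"
  assumes "A \<in> carrier_mat m d" "v \<in> carrier_vec d"
  shows "(c \<cdot>\<^sub>m A) *\<^sub>v v = c \<cdot>\<^sub>v (A *\<^sub>v v)"
  using assms
  by (intro eq_vecI) (auto simp: scalar_prod_def sum_distrib_left mult.assoc intro!: sum.cong)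

lemma transpose_smult: "transpose_mat (c \<cdot>\<^sub>m A) = c \<cdot>\<^sub>m transpose_mat A"
  by (intro eq_matI) auto

lemma mat_inv_inverts:
  assumes A: "A \<in> carrier_mat d d" and "Determinant.det A \<noteq> 0"
  shows "mat_inv A \<in> carrier_mat d d" "A * mat_inv A = 1\<^sub>m d" "mat_inv A * A = 1\<^sub>m d"
proof -
  \<comment> \<open>The result \<open>None\<close> would mean that \<open>A\<close> is not a unit of
    the matrix ring, which a nonzero determinant excludes; \<open>undefined\<close> fills a free
    parameter of that ring.\<close>
  obtain B where "mat_inverse A = Some B"
    using mat_inverse(1)[OF A, of undefined] det_non_zero_imp_unit[OF A assms(2), of undefined]
    by (cases "mat_inverse A") auto
  with mat_inverse(2)[OF A this]
  show "mat_inv A \<in> carrier_mat d d" "A * mat_inv A = 1\<^sub>m d" "mat_inv A * A = 1\<^sub>m d"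
    by (auto simp: mat_inv_def)
qed

text \<open>Transposing \<open>A * mat_inv A = 1\<close> makes the transposed inverse a left inverse
  of the symmetric \<open>A\<close>, and left and right inverses agree.\<close>

lemma transpose_mat_inv:
  assumes A: "A \<in> carrier_mat d d" and "Determinant.det A \<noteq> 0" and sym: "transpose_mat A = A"
  shows "transpose_mat (mat_inv A) = mat_inv A"
proof -
  note I = mat_inv_inverts[OF A assms(2)]
  have "transpose_mat (mat_inv A) * A = 1\<^sub>m d"
    using transpose_mult[OF A I(1)] I(2) sym by simp
  hence "transpose_mat (mat_inv A) * A * mat_inv A = mat_inv A"
    using I(1) by simp
  thus ?thesis
    using assoc_mult_mat[of "transpose_mat (mat_inv A)" d d A d "mat_inv A" d] I(1,2) A by simp
qed

lemma scalar_prod_symmetric_mat: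
  fixes A :: "real Matrix.mat"
  assumes A: "A \<in> carrier_mat d d" and "transpose_mat A = A"
    and x: "x \<in> carrier_vec d" and y: "y \<in> carrier_vec d"
  shows "scalar_prod x (A *\<^sub>v y) = scalar_prod y (A *\<^sub>v x)"
  using transpose_vec_mult_scalar[OF A x y] assms
  by (simp add: comm_scalar_prod[of x d "A *\<^sub>v y"])

section \<open>Rank-one downdates by the outer product x x^T, written
  \<open>vec_square x\<close>\<close>

definition vec_square :: "real Matrix.vec \<Rightarrow> real Matrix.mat" where
  "vec_square x = Matrix.mat (dim_vec x) (dim_vec x) (\<lambda>(i, j). vec_index x i * vec_index x j)"

lemma vec_square_carrier: "x \<in> carrier_vec d \<Longrightarrow> vec_square x \<in> carrier_mat d d"
  by (simp add: vec_square_def)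

lemma vec_square_mult_vec:
  assumes x: "x \<in> carrier_vec d" and v: "v \<in> carrier_vec d"
  shows "vec_square x *\<^sub>v v = scalar_prod x v \<cdot>\<^sub>v x"
  using assms
  by (intro eq_vecI) (auto simp: vec_square_def scalar_prod_def sum_distrib_left sum_distrib_right
      intro!: sum.cong)

text \<open>The matrix determinant lemma. The bordered matrix with blocks A, x, x^T, 1 has two
  factorizations into block triangular matrices: one through the Schur complement of the corner 1,
  which is A - x x^T, and one through that of A, which is the scalar 1 - x^T A^-1 x. Their
  determinants agree.\<close>

lemma det_minus_vec_square:
  assumes A: "A \<in> carrier_mat d d" and det: "Determinant.det A \<noteq> 0" and x: "x \<in> carrier_vec d"
  shows "Determinant.det (A - vec_square x) =
    Determinant.det A * (1 - scalar_prod x (mat_inv A *\<^sub>v x))"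
proof -
  note I = mat_inv_inverts[OF A det]
  define U where "U = mat_of_cols d [x]"
  define V where "V = mat_of_rows d [x]"
  define W where "W = V * (mat_inv A * U)"
  have U: "U \<in> carrier_mat d 1" and V: "V \<in> carrier_mat 1 d"
    unfolding U_def V_def by auto
  have W: "W \<in> carrier_mat 1 1" using U V I(1) by (auto simp: W_def)
  have UV: "vec_square x = U * V"
    using x by (intro eq_matI)
      (auto simp: vec_square_def U_def V_def scalar_prod_def mat_of_cols_def mat_of_rows_def)
  have colU: "Matrix.col U 0 = x" and rowV: "Matrix.row V 0 = x"
    using x by (auto simp: U_def V_def)
  have W0: "W $$ (0, 0) = scalar_prod x (mat_inv A *\<^sub>v x)"
  proof -
    have "Matrix.col (mat_inv A * U) 0 = mat_inv A *\<^sub>v x"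
      using col_mult2[OF I(1) U, of 0] colU by simp
    thus ?thesis using U V I(1) by (simp add: W_def rowV)
  qed
  let ?M = "four_block_mat A U V (1\<^sub>m 1)"
  have UVc: "U * V \<in> carrier_mat d d" using U V by simp
  have "four_block_mat (A - U * V) U (0\<^sub>m 1 d) (1\<^sub>m 1) * four_block_mat (1\<^sub>m d) (0\<^sub>m d 1) V (1\<^sub>m 1)
    = four_block_mat ((A - U * V) * 1\<^sub>m d + U * V) ((A - U * V) * 0\<^sub>m d 1 + U * 1\<^sub>m 1)
        (0\<^sub>m 1 d * 1\<^sub>m d + 1\<^sub>m 1 * V) (0\<^sub>m 1 d * 0\<^sub>m d 1 + 1\<^sub>m 1 * 1\<^sub>m 1)"
    by (rule mult_four_block_mat) (use A U V UVc in auto)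
  also have "\<dots> = ?M"
  proof -
    have "(A - U * V) * 1\<^sub>m d + U * V = A"
      using A U V minus_carrier_mat[OF UVc, of A]
      by (subst right_mult_one_mat[of _ d d]) (auto intro!: eq_matI)
    moreover have "(A - U * V) * 0\<^sub>m d 1 + U * 1\<^sub>m 1 = U"
      unfolding right_mult_zero_mat[OF minus_carrier_mat[OF UVc]] using U by simp
    ultimately show ?thesis using V by simp
  qed
  finally have M1: "?M = four_block_mat (A - U * V) U (0\<^sub>m 1 d) (1\<^sub>m 1) *
    four_block_mat (1\<^sub>m d) (0\<^sub>m d 1) V (1\<^sub>m 1)" ..
  have "four_block_mat A (0\<^sub>m d 1) V (1\<^sub>m 1) *
      four_block_mat (1\<^sub>m d) (mat_inv A * U) (0\<^sub>m 1 d) (1\<^sub>m 1 - W)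
    = four_block_mat (A * 1\<^sub>m d + 0\<^sub>m d 1 * 0\<^sub>m 1 d) (A * (mat_inv A * U) + 0\<^sub>m d 1 * (1\<^sub>m 1 - W))
        (V * 1\<^sub>m d + 1\<^sub>m 1 * 0\<^sub>m 1 d) (V * (mat_inv A * U) + 1\<^sub>m 1 * (1\<^sub>m 1 - W))"
    by (rule mult_four_block_mat) (use A U V W I in auto)
  also have "\<dots> = ?M"
  proof -
    have "A * (mat_inv A * U) = U"
      using assoc_mult_mat[OF A I(1) U, symmetric] I(2) U by simp
    moreover have "0\<^sub>m d 1 * (1\<^sub>m 1 - W) = 0\<^sub>m d 1"
      by (rule left_mult_zero_mat) (use W in auto)
    moreover have "V * (mat_inv A * U) + 1\<^sub>m 1 * (1\<^sub>m 1 - W) = 1\<^sub>m 1"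
      unfolding W_def[symmetric] using W by (auto intro!: eq_matI)
    ultimately show ?thesis using A U V by simp
  qed
  finally have M2: "?M = four_block_mat A (0\<^sub>m d 1) V (1\<^sub>m 1) *
    four_block_mat (1\<^sub>m d) (mat_inv A * U) (0\<^sub>m 1 d) (1\<^sub>m 1 - W)" ..
  have AUV: "A - U * V \<in> carrier_mat d d" by (rule minus_carrier_mat[OF UVc])
  have AiU: "mat_inv A * U \<in> carrier_mat d 1" using I(1) U by simp
  have W1: "1\<^sub>m 1 - W \<in> carrier_mat 1 1" by (rule minus_carrier_mat[OF W])
  have "Determinant.det ?M = Determinant.det (four_block_mat (A - U * V) U (0\<^sub>m 1 d) (1\<^sub>m 1)) *
      Determinant.det (four_block_mat (1\<^sub>m d) (0\<^sub>m d 1) V (1\<^sub>m 1))"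
    unfolding M1 by (rule det_mult[of _ "d + 1"]) (intro four_block_carrier_mat AUV one_carrier_mat)+
  also have "Determinant.det (four_block_mat (A - U * V) U (0\<^sub>m 1 d) (1\<^sub>m 1)) =
      Determinant.det (A - U * V) * Determinant.det (1\<^sub>m 1 :: real Matrix.mat)"
    by (rule det_four_block_mat_lower_left_zero[OF AUV U refl one_carrier_mat])
  also have "Determinant.det (four_block_mat (1\<^sub>m d) (0\<^sub>m d 1) V (1\<^sub>m 1)) =
      Determinant.det (1\<^sub>m d :: real Matrix.mat) * Determinant.det (1\<^sub>m 1 :: real Matrix.mat)"
    by (rule det_four_block_mat_upper_right_zero[OF one_carrier_mat refl V one_carrier_mat])
  finally have "Determinant.det ?M = Determinant.det (A - U * V)" by simp
  moreover have "Determinant.det ?M = Determinant.det A * Determinant.det (1\<^sub>m 1 - W)"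
  proof -
    have "Determinant.det ?M = Determinant.det (four_block_mat A (0\<^sub>m d 1) V (1\<^sub>m 1)) *
        Determinant.det (four_block_mat (1\<^sub>m d) (mat_inv A * U) (0\<^sub>m 1 d) (1\<^sub>m 1 - W))"
      unfolding M2 by (rule det_mult[of _ "d + 1"])
        (intro four_block_carrier_mat A W1 one_carrier_mat)+
    also have "Determinant.det (four_block_mat A (0\<^sub>m d 1) V (1\<^sub>m 1)) =
        Determinant.det A * Determinant.det (1\<^sub>m 1 :: real Matrix.mat)"
      by (rule det_four_block_mat_upper_right_zero[OF A refl V one_carrier_mat])
    also have "Determinant.det (four_block_mat (1\<^sub>m d) (mat_inv A * U) (0\<^sub>m 1 d) (1\<^sub>m 1 - W)) =
        Determinant.det (1\<^sub>m d :: real Matrix.mat) * Determinant.det (1\<^sub>m 1 - W)"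
      by (rule det_four_block_mat_lower_left_zero[OF one_carrier_mat AiU refl W1])
    finally show ?thesis by simp
  qed
  moreover have "Determinant.det (1\<^sub>m 1 - W) = 1 - W $$ (0, 0)"
    using W by (subst det_single) auto
  ultimately show ?thesis unfolding UV W0 by simp
qed

text \<open>Sherman-Morrison for the quadratic form, without a formula for the full inverse. The
  vector w = (A - x x^T)^-1 v solves A w = v + (x . w) x, which determines w up to the scalar x . w.
  Pairing with x yields that scalar, and pairing with v yields the claim.\<close>

lemma mat_inv_minus_vec_square:
  fixes A :: "real Matrix.mat"
  assumes A: "A \<in> carrier_mat d d" and det: "Determinant.det A \<noteq> 0" and sym: "transpose_mat A = A"
    and x: "x \<in> carrier_vec d" and v: "v \<in> carrier_vec d"
    and h: "1 - scalar_prod x (mat_inv A *\<^sub>v x) \<noteq> 0"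
  shows "scalar_prod v (mat_inv (A - vec_square x) *\<^sub>v v) = scalar_prod v (mat_inv A *\<^sub>v v) +
    (scalar_prod x (mat_inv A *\<^sub>v v))\<^sup>2 / (1 - scalar_prod x (mat_inv A *\<^sub>v x))"
proof -
  define B where "B = A - vec_square x"
  have xc: "vec_square x \<in> carrier_mat d d" using x by (rule vec_square_carrier)
  have B: "B \<in> carrier_mat d d" unfolding B_def by (rule minus_carrier_mat[OF xc])
  have detB: "Determinant.det B \<noteq> 0"
    using det_minus_vec_square[OF A det x] det h by (simp add: B_def)
  note IA = mat_inv_inverts[OF A det] and IB = mat_inv_inverts[OF B detB]
  define w where "w = mat_inv B *\<^sub>v v"
  have w: "w \<in> carrier_vec d" using IB v by (simp add: w_def)
  let ?c = "scalar_prod x w"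
  have "v = B *\<^sub>v w"
    using assoc_mult_mat_vec[OF B IB(1) v] IB(2) v by (simp add: w_def)
  also have "\<dots> = A *\<^sub>v w - vec_square x *\<^sub>v w"
    unfolding B_def by (rule minus_mult_distrib_mat_vec[OF A xc w])
  also have "\<dots> = A *\<^sub>v w - ?c \<cdot>\<^sub>v x"
    by (simp add: vec_square_mult_vec[OF x w])
  finally have "A *\<^sub>v w = v + ?c \<cdot>\<^sub>v x"
    using A x v w by (auto intro!: eq_vecI dest!: arg_cong[of v _ "\<lambda>u. vec_index u _"])
  hence "mat_inv A *\<^sub>v (A *\<^sub>v w) = mat_inv A *\<^sub>v v + ?c \<cdot>\<^sub>v (mat_inv A *\<^sub>v x)"
    using IA x v by (simp add: mult_add_distrib_mat_vec[of _ d d] mult_mat_vec[of _ d d])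
  hence weq: "w = mat_inv A *\<^sub>v v + ?c \<cdot>\<^sub>v (mat_inv A *\<^sub>v x)"
    using assoc_mult_mat_vec[OF IA(1) A w] IA(3) w by simp
  have Av: "mat_inv A *\<^sub>v v \<in> carrier_vec d" "mat_inv A *\<^sub>v x \<in> carrier_vec d"
    using IA v x by auto
  have inner: "scalar_prod u w = scalar_prod u (mat_inv A *\<^sub>v v) + ?c * scalar_prod u (mat_inv A *\<^sub>v x)"
    if u: "u \<in> carrier_vec d" for u
    by (subst weq) (use u Av in \<open>simp add: scalar_prod_add_distrib[of _ d]\<close>)
  have "scalar_prod v (mat_inv A *\<^sub>v x) = scalar_prod x (mat_inv A *\<^sub>v v)"
    using scalar_prod_symmetric_mat[OF IA(1) transpose_mat_inv[OF A det sym] v x] .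
  moreover have "?c = scalar_prod x (mat_inv A *\<^sub>v v) / (1 - scalar_prod x (mat_inv A *\<^sub>v x))"
    using inner[OF x] h by (simp add: field_simps)
  ultimately show ?thesis
    using inner[OF v] by (simp add: B_def[symmetric] w_def[symmetric] power2_eq_square)
qed

section \<open>Regularized Gram matrices and the effective dimension\<close>

lemma mat_trace_comm:
  assumes "A \<in> carrier_mat m d" "B \<in> carrier_mat d m"
  shows "mat_trace (A * B) = mat_trace (B * A)"
  using assms
  by (auto simp: mat_trace_def scalar_prod_def atLeast0LessThan mult.commute intro: sum.swap)

lemma reg_gram_carrier: "Y \<in> carrier_mat m d \<Longrightarrow> reg_gram Y l \<in> carrier_mat d d"
  by (simp add: reg_gram_def)

lemma transpose_reg_gram: "transpose_mat (reg_gram Y l) = reg_gram Y l"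
  unfolding reg_gram_def
  by (intro eq_matI) (auto simp: scalar_prod_def mult.commute)

lemma reg_gram_quadratic:
  assumes Y: "Y \<in> carrier_mat m d" and v: "v \<in> carrier_vec d"
  shows "scalar_prod v (reg_gram Y l *\<^sub>v v) =
    scalar_prod (Y *\<^sub>v v) (Y *\<^sub>v v) + l * scalar_prod v v"
proof -
  have "reg_gram Y l *\<^sub>v v = transpose_mat Y *\<^sub>v (Y *\<^sub>v v) + l \<cdot>\<^sub>v v"
    unfolding reg_gram_def using Y v
    by (subst add_mult_distrib_mat_vec[of _ d d])
      (auto simp: smult_mat_mult_vec[of _ d d] intro!: assoc_mult_mat_vec)
  moreover have "scalar_prod v (transpose_mat Y *\<^sub>v (Y *\<^sub>v v)) = scalar_prod (Y *\<^sub>v v) (Y *\<^sub>v v)"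
    using transpose_vec_mult_scalar[of "transpose_mat Y" d m "Y *\<^sub>v v" v] Y v by simp
  ultimately show ?thesis
    using Y v by (simp add: scalar_prod_add_distrib[of _ d])
qed

lemma real_scalar_prod_ge_0: "0 \<le> scalar_prod v (v :: real Matrix.vec)"
  by (simp add: scalar_prod_def sum_nonneg)

text \<open>Since \<open>reg_gram Y l\<close> maps \<open>u\<close> to \<open>v\<close>, this is the
  quadratic form of the Gram matrix at \<open>u\<close>. For \<open>l\<close> nonnegative it bounds
  |Y u|^2 by the left-hand side.\<close>

lemma mat_inv_reg_gram_quadratic:
  assumes Y: "Y \<in> carrier_mat m d" and v: "v \<in> carrier_vec d"
    and det: "Determinant.det (reg_gram Y l) \<noteq> 0"
  defines "u \<equiv> mat_inv (reg_gram Y l) *\<^sub>v v"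
  shows "scalar_prod v u = scalar_prod (Y *\<^sub>v u) (Y *\<^sub>v u) + l * scalar_prod u u"
proof -
  note G = reg_gram_carrier[OF Y, of l]
  note I = mat_inv_inverts[OF G det]
  have u: "u \<in> carrier_vec d" using I v by (simp add: u_def)
  have "reg_gram Y l *\<^sub>v u = v"
    using assoc_mult_mat_vec[OF G I(1) v] I(2) v by (simp add: u_def)
  thus ?thesis using reg_gram_quadratic[OF Y u, of l] u v by (simp add: comm_scalar_prod[of v d])
qed

text \<open>The summands are the diagonal entries of the hat matrix. This identifies the normalizing
  constant of the removal weights.\<close>

lemma eff_dim_eq_sum_rows:
  assumes Y: "Y \<in> carrier_mat m d" and det: "Determinant.det (reg_gram Y l) \<noteq> 0"
  shows "eff_dim Y l =
    (\<Sum>k<m. scalar_prod (Matrix.row Y k) (mat_inv (reg_gram Y l) *\<^sub>v Matrix.row Y k))"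
proof -
  note I = mat_inv_inverts[OF reg_gram_carrier[OF Y] det]
  let ?I = "mat_inv (reg_gram Y l)"
  have "(Y * ?I * transpose_mat Y) $$ (k, k) = scalar_prod (Matrix.row Y k) (?I *\<^sub>v Matrix.row Y k)"
    if k: "k < m" for k
  proof -
    have "Y * ?I * transpose_mat Y = Y * (?I * transpose_mat Y)"
      using assoc_mult_mat[OF Y I(1), of "transpose_mat Y" m] Y by simp
    moreover have "Matrix.col (?I * transpose_mat Y) k = ?I *\<^sub>v Matrix.row Y k"
      using col_mult2[OF I(1), of "transpose_mat Y" m k] Y k by simp
    ultimately show ?thesis using Y k I(1) by simp
  qed
  thus ?thesis using Y by (simp add: eff_dim_def mat_trace_def)
qed

text \<open>By cyclicity the trace is that of Y^T Y G^-1 with G = Y^T Y + l I, and Y^T Y = G - l I.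
  In this form the effective dimensions of different row sets can be compared through their d x d
  inverses.\<close>

lemma eff_dim_eq_trace:
  assumes Y: "Y \<in> carrier_mat m d" and det: "Determinant.det (reg_gram Y l) \<noteq> 0"
  shows "eff_dim Y l = d - l * mat_trace (mat_inv (reg_gram Y l))"
proof -
  note I = mat_inv_inverts[OF reg_gram_carrier[OF Y] det]
  let ?I = "mat_inv (reg_gram Y l)"
  have YI: "Y * ?I \<in> carrier_mat m d" and YT: "transpose_mat Y \<in> carrier_mat d m"
    using Y I by auto
  have YY: "transpose_mat Y * Y \<in> carrier_mat d d" using Y by auto
  have "eff_dim Y l = mat_trace (transpose_mat Y * (Y * ?I))"
    unfolding eff_dim_def by (rule mat_trace_comm[OF YI YT])
  also have "transpose_mat Y * (Y * ?I) = (transpose_mat Y * Y) * ?I"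
    using assoc_mult_mat[OF YT Y I(1)] by simp
  also have "\<dots> = (reg_gram Y l - l \<cdot>\<^sub>m 1\<^sub>m d) * ?I"
  proof -
    have "transpose_mat Y * Y = reg_gram Y l - l \<cdot>\<^sub>m 1\<^sub>m d"
      using Y by (auto simp: reg_gram_def intro!: eq_matI)
    thus ?thesis by simp
  qed
  also have "\<dots> = 1\<^sub>m d - l \<cdot>\<^sub>m ?I"
    using I by (subst minus_mult_distrib_mat[OF reg_gram_carrier[OF Y]])
      (auto simp: mult_smult_assoc_mat[of _ d d])
  also have "mat_trace \<dots> = d - l * mat_trace ?I"
    using I(1) by (simp add: mat_trace_def sum_subtractf sum_distrib_left)
  finally show ?thesis .
qed

section \<open>Nonsingularity at the start, and quadratic forms of expectations\<close>

lemma full_rank_imp_inj: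
  fixes X :: "real Matrix.mat"
  assumes X: "X \<in> carrier_mat n d" and rank: "vec_space.rank n X = d"
    and v: "v \<in> carrier_vec d" and Xv: "X *\<^sub>v v = 0\<^sub>v n"
  shows "v = 0\<^sub>v d"
proof (rule ccontr)
  interpret vec_space "TYPE(real)" n .
  assume "v \<noteq> 0\<^sub>v d"
  show False
  proof (cases "distinct (cols X)")
    case True
    with lin_depI[OF X v \<open>v \<noteq> 0\<^sub>v d\<close> Xv] full_rank_lin_indpt[OF X rank] show False by simp
  next
    case False
    \<comment> \<open>Independence concerns the set of columns, which hides repetitions. A repeated
      column leaves fewer than \<open>d\<close> distinct ones, too few for rank
      \<open>d\<close>.\<close>
    obtain S where S: "maximal S (\<lambda>T. T \<subseteq> set (cols X) \<and> lin_indpt T)"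
      using maximal_exists[of "(\<lambda>T. T \<subseteq> set (cols X) \<and> lin_indpt T)" "card (set (cols X))" "{}"]
      by (meson List.finite_set card_mono empty_iff empty_subsetI finite_lin_indpt2 rev_finite_subset)
    then have "card S \<le> card (set (cols X))" by (simp add: card_mono maximal_def)
    also have "\<dots> < d"
      using False card_distinct[of "cols X"] card_length[of "cols X"] X
      by (metis carrier_matD(2) cols_length nat_less_le)
    finally show False using rank_card_indpt[OF X S] rank by simp
  qed
qed

text \<open>A nonzero kernel vector v would satisfy |X v|^2 + l |v|^2 = 0 with both terms
  nonnegative. If l > 0 this forces v = 0; if l = 0 it forces X v = 0, contradicting full column
  rank.\<close>

lemma det_reg_gram_nonzero:
  assumes X: "X \<in> carrier_mat n d" and l: "l \<ge> 0"
    and rank: "l = 0 \<Longrightarrow> vec_space.rank n X = d"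
  shows "Determinant.det (reg_gram X l) \<noteq> 0"
proof
  assume "Determinant.det (reg_gram X l) = 0"
  then obtain v where v: "v \<in> carrier_vec d" "v \<noteq> 0\<^sub>v d" "reg_gram X l *\<^sub>v v = 0\<^sub>v d"
    using det_0_iff_vec_prod_zero_field[OF reg_gram_carrier[OF X]] by auto
  have zero: "w = 0\<^sub>v k" if "w \<in> carrier_vec k" "scalar_prod w w \<le> 0" for w :: "real Matrix.vec" and k
    using that real_scalar_prod_ge_0[of w]
    by (intro eq_vecI) (auto simp: scalar_prod_def sum_nonneg_eq_0_iff order_antisym_conv)
  have sum0: "scalar_prod (X *\<^sub>v v) (X *\<^sub>v v) + l * scalar_prod v v = 0"
    using reg_gram_quadratic[OF X v(1), of l] v(1,3) by simp
  have lv: "0 \<le> l * scalar_prod v v" using l real_scalar_prod_ge_0[of v] by simp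
  show False
  proof (cases "l = 0")
    case True
    have "X *\<^sub>v v = 0\<^sub>v n" by (rule zero) (use sum0 lv mult_mat_vec_carrier[OF X v(1)] in auto)
    with full_rank_imp_inj[OF X rank[OF True] v(1)] v(2) show False by simp
  next
    case False
    have "l * scalar_prod v v \<le> 0" using sum0 real_scalar_prod_ge_0[of "X *\<^sub>v v"] by linarith
    hence "scalar_prod v v \<le> 0" using False l by (simp add: mult_le_0_iff)
    with zero[OF v(1)] v(2) show False by simp
  qed
qed

text \<open>A quadratic form is linear in the matrix entries, so it commutes with a finite
  expectation. This reduces the Loewner inequality to a scalar one for each \<open>v\<close>. The
  carrier condition is confined to the support because \<open>mat_inv\<close> may be unspecified
  elsewhere.\<close>

lemma mat_expectation_quadratic:
  assumes fin: "finite (set_pmf p)" and M: "\<And>\<omega>. \<omega> \<in> set_pmf p \<Longrightarrow> M \<omega> \<in> carrier_mat d d"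
    and v: "v \<in> carrier_vec d"
  shows "scalar_prod v (mat_expectation d p M *\<^sub>v v) =
    measure_pmf.expectation p (\<lambda>\<omega>. scalar_prod v (M \<omega> *\<^sub>v v))"
proof -
  have E: "measure_pmf.expectation p f = (\<Sum>\<omega>\<in>set_pmf p. f \<omega> * pmf p \<omega>)" for f :: "'a \<Rightarrow> real"
    by (rule integral_measure_pmf_real[OF fin]) auto
  have quad: "scalar_prod v (A *\<^sub>v v) = (\<Sum>i<d. \<Sum>j<d. vec_index v i * (A $$ (i, j) * vec_index v j))"
    if "A \<in> carrier_mat d d" for A
    using that v by (simp add: scalar_prod_def atLeast0LessThan sum_distrib_left)
  have "scalar_prod v (mat_expectation d p M *\<^sub>v v) = (\<Sum>i<d. \<Sum>j<d. vec_index v i *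
      ((\<Sum>\<omega>\<in>set_pmf p. M \<omega> $$ (i, j) * pmf p \<omega>) * vec_index v j))"
    by (subst quad) (auto simp: mat_expectation_def E)
  also have "\<dots> = (\<Sum>i<d. \<Sum>j<d. \<Sum>\<omega>\<in>set_pmf p.
      vec_index v i * (M \<omega> $$ (i, j) * vec_index v j) * pmf p \<omega>)"
    by (simp add: sum_distrib_left sum_distrib_right mult_ac)
  also have "\<dots> = (\<Sum>\<omega>\<in>set_pmf p. \<Sum>i<d. \<Sum>j<d.
      vec_index v i * (M \<omega> $$ (i, j) * vec_index v j) * pmf p \<omega>)"
    by (subst (2) sum.swap, subst sum.swap) simp
  also have "\<dots> = measure_pmf.expectation p (\<lambda>\<omega>. scalar_prod v (M \<omega> *\<^sub>v v))"
    unfolding E by (intro sum.cong refl) (simp add: quad[OF M] sum_distrib_right)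
  finally show ?thesis .
qed

section \<open>Row submatrices and their Gram matrices\<close>

locale regularized_rows =
  fixes X :: "real Matrix.mat" and n d :: nat and l :: real
  assumes X: "X \<in> carrier_mat n d" and l: "l \<ge> 0"
begin

abbreviation gram :: "nat set \<Rightarrow> real Matrix.mat" where
  "gram S \<equiv> reg_gram (row_submatrix X S) l"

text \<open>This is q(S) of the overview.\<close>

abbreviation energy :: "nat set \<Rightarrow> real Matrix.vec \<Rightarrow> real" where
  "energy S v \<equiv> scalar_prod v (mat_inv (gram S) *\<^sub>v v)"

lemma row_carrier: "i < n \<Longrightarrow> Matrix.row X i \<in> carrier_vec d"
  using X by auto

lemma card_rows: "S \<subseteq> {..<n} \<Longrightarrow> card {i. i < n \<and> i \<in> S} = card S"
  by (rule arg_cong[of _ _ card]) auto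

lemma row_submatrix_carrier: "S \<subseteq> {..<n} \<Longrightarrow> row_submatrix X S \<in> carrier_mat (card S) d"
  using X by (auto simp: row_submatrix_def submatrix_def card_rows)

lemma row_submatrix_index:
  assumes "S \<subseteq> {..<n}" "k < card S" "j < d"
  shows "row_submatrix X S $$ (k, j) = X $$ (pick S k, j)"
  using assms X unfolding row_submatrix_def
  by (subst submatrix_index) (auto simp: card_rows pick_UNIV)

text \<open>\<open>pick S\<close> enumerates \<open>S\<close> increasingly, hence injectively;
  comparing cardinalities makes it onto.\<close>

lemma bij_betw_pick:
  assumes "S \<subseteq> {..<n}"
  shows "bij_betw (pick S) {..<card S} S"
proof -
  have "inj_on (pick S) {..<card S}"
    by (rule linorder_inj_onI) (use pick_mono_le in force)+
  moreover have "pick S ` {..<card S} \<subseteq> S" using pick_in_set_le by auto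
  moreover have "finite S" using assms finite_subset by blast
  ultimately show ?thesis
    by (simp add: bij_betw_def card_image card_subset_eq)
qed

text \<open>Row \<open>k\<close> of the submatrix is row \<open>pick S k\<close> of
  \<open>X\<close>. Sums over positions thus become sums over the original indices, which do not
  shift when another row is removed.\<close>

lemma sum_row_submatrix:
  assumes S: "S \<subseteq> {..<n}"
  shows "(\<Sum>k<card S. f (Matrix.row (row_submatrix X S) k)) = (\<Sum>i\<in>S. f (Matrix.row X i))"
proof -
  have "Matrix.row (row_submatrix X S) k = Matrix.row X (pick S k)" if "k < card S" for k
  proof (rule eq_vecI)
    have "pick S k < n" using pick_in_set_le[OF that] S by auto
    thus "vec_index (Matrix.row (row_submatrix X S) k) j = vec_index (Matrix.row X (pick S k)) j"
      if "j < dim_vec (Matrix.row X (pick S k))" for j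
      using that \<open>k < card S\<close> X row_submatrix_carrier[OF S]
      by (simp add: row_submatrix_index[OF S])
  qed (use X row_submatrix_carrier[OF S] in auto)
  hence "(\<Sum>k<card S. f (Matrix.row (row_submatrix X S) k)) = (\<Sum>k<card S. f (Matrix.row X (pick S k)))"
    by simp
  also have "\<dots> = (\<Sum>i\<in>S. f (Matrix.row X i))"
    by (rule sum.reindex_bij_betw[OF bij_betw_pick[OF S]])
  finally show ?thesis .
qed

lemma row_submatrix_all: "row_submatrix X {..<n} = X"
proof (rule eq_matI)
  fix i j assume ij: "i < dim_row X" "j < dim_col X"
  \<comment> \<open>Exactly \<open>i\<close> elements of the full index set lie below
    \<open>i\<close>, so \<open>pick\<close> returns \<open>i\<close>.\<close>
  hence "{a \<in> {..<n}. a < i} = {..<i}" using X by auto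
  hence "pick {..<n} i = i" using pick_card_in_set[of i "{..<n}"] ij X by simp
  thus "row_submatrix X {..<n} $$ (i, j) = X $$ (i, j)"
    using row_submatrix_index[of "{..<n}" i j] ij X by simp
qed (use row_submatrix_carrier[of "{..<n}"] X in auto)

lemma gram_carrier: "S \<subseteq> {..<n} \<Longrightarrow> gram S \<in> carrier_mat d d"
  by (rule reg_gram_carrier[OF row_submatrix_carrier])

lemma gram_index:
  assumes S: "S \<subseteq> {..<n}" and jk: "j < d" "k < d"
  shows "gram S $$ (j, k) = (\<Sum>i\<in>S. X $$ (i, j) * X $$ (i, k)) + (if j = k then l else 0)"
proof -
  have "gram S $$ (j, k) = (\<Sum>m<card S. vec_index (Matrix.row (row_submatrix X S) m) j *
      vec_index (Matrix.row (row_submatrix X S) m) k) + (if j = k then l else 0)"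
    using jk row_submatrix_carrier[OF S]
    by (simp add: reg_gram_def scalar_prod_def atLeast0LessThan)
  also have "(\<Sum>m<card S. vec_index (Matrix.row (row_submatrix X S) m) j *
      vec_index (Matrix.row (row_submatrix X S) m) k) =
      (\<Sum>i\<in>S. vec_index (Matrix.row X i) j * vec_index (Matrix.row X i) k)"
    by (rule sum_row_submatrix[OF S])
  also have "\<dots> = (\<Sum>i\<in>S. X $$ (i, j) * X $$ (i, k))"
    using S X jk by (intro sum.cong) auto
  finally show ?thesis .
qed

text \<open>The Gram matrix is l I plus the outer products of the rows in \<open>S\<close>, so
  deleting a row is a rank-one downdate.\<close>

lemma gram_remove:
  assumes S: "S \<subseteq> {..<n}" and i: "i \<in> S"
  shows "gram (S - {i}) = gram S - vec_square (Matrix.row X i)"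
proof -
  have S': "S - {i} \<subseteq> {..<n}" and fin: "finite S" using S finite_subset by blast+
  have "i < n" using S i by auto
  thus ?thesis
    using X gram_carrier[OF S] gram_carrier[OF S'] i fin
    by (intro eq_matI)
      (auto simp: gram_index[OF S] gram_index[OF S'] vec_square_def sum.remove)
qed

section \<open>Ridge leverage scores and the effect of removing one row\<close>

definition leverage :: "nat set \<Rightarrow> nat \<Rightarrow> real" where
  "leverage S i = energy S (Matrix.row X i)"

lemma det_gram_remove:
  assumes S: "S \<subseteq> {..<n}" and i: "i \<in> S" and det: "Determinant.det (gram S) \<noteq> 0"
  shows "Determinant.det (gram (S - {i})) = Determinant.det (gram S) * (1 - leverage S i)"
  unfolding gram_remove[OF S i] leverage_def
  by (rule det_minus_vec_square[OF gram_carrier[OF S] det row_carrier]) (use S i in auto)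

lemma removal_weight_eq:
  assumes S: "S \<subseteq> {..<n}" and i: "i \<in> S" and det: "Determinant.det (gram S) \<noteq> 0"
  shows "removal_weight X l S i = 1 - leverage S i"
  using det_gram_remove[OF assms] det by (simp add: removal_weight_def)

lemma energy_nonneg:
  assumes S: "S \<subseteq> {..<n}" and det: "Determinant.det (gram S) \<noteq> 0" and v: "v \<in> carrier_vec d"
  shows "0 \<le> energy S v"
  using mat_inv_reg_gram_quadratic[OF row_submatrix_carrier[OF S] v det] l
  by (simp add: real_scalar_prod_ge_0)

text \<open>With u = A^-1 v the left side is |X_S u|^2, and the energy exceeds it by l
  |u|^2.\<close>

lemma sum_row_products_squared_le_energy:
  assumes S: "S \<subseteq> {..<n}" and det: "Determinant.det (gram S) \<noteq> 0" and v: "v \<in> carrier_vec d"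
  shows "(\<Sum>i\<in>S. (scalar_prod (Matrix.row X i) (mat_inv (gram S) *\<^sub>v v))\<^sup>2) \<le> energy S v"
proof -
  define u where "u = mat_inv (gram S) *\<^sub>v v"
  note Y = row_submatrix_carrier[OF S]
  have "(\<Sum>i\<in>S. (scalar_prod (Matrix.row X i) u)\<^sup>2) =
      (\<Sum>k<card S. (scalar_prod (Matrix.row (row_submatrix X S) k) u)\<^sup>2)"
    by (rule sum_row_submatrix[OF S, symmetric])
  also have "\<dots> = scalar_prod (row_submatrix X S *\<^sub>v u) (row_submatrix X S *\<^sub>v u)"
    using Y by (simp add: scalar_prod_def[of "_ *\<^sub>v _"] atLeast0LessThan power2_eq_square)
  also have "\<dots> \<le> energy S v"
    using mat_inv_reg_gram_quadratic[OF Y v det] l real_scalar_prod_ge_0[of u]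
    by (simp add: u_def)
  finally show ?thesis by (simp add: u_def)
qed

text \<open>Take v to be row \<open>i\<close> itself in the preceding bound. The term of index
  \<open>i\<close> is then the squared leverage and the bound is the leverage, so t^2 <= t for t the
  leverage.\<close>

lemma leverage_le_1:
  assumes S: "S \<subseteq> {..<n}" and i: "i \<in> S" and det: "Determinant.det (gram S) \<noteq> 0"
  shows "leverage S i \<le> 1"
proof -
  have ri: "Matrix.row X i \<in> carrier_vec d" using row_carrier S i by auto
  have "(leverage S i)\<^sup>2 \<le> (\<Sum>k\<in>S. (scalar_prod (Matrix.row X k) (mat_inv (gram S) *\<^sub>v Matrix.row X i))\<^sup>2)"
    unfolding leverage_def using i S finite_subset by (intro member_le_sum) auto
  also have "\<dots> \<le> leverage S i"
    unfolding leverage_def by (rule sum_row_products_squared_le_energy[OF S det ri])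
  finally show ?thesis
    using power_strict_increasing[of 1 2 "leverage S i"] by (cases "1 < leverage S i") auto
qed

lemma energy_remove:
  assumes S: "S \<subseteq> {..<n}" and i: "i \<in> S" and det: "Determinant.det (gram S) \<noteq> 0"
    and v: "v \<in> carrier_vec d" and h: "leverage S i \<noteq> 1"
  shows "energy (S - {i}) v = energy S v +
    (scalar_prod (Matrix.row X i) (mat_inv (gram S) *\<^sub>v v))\<^sup>2 / (1 - leverage S i)"
  unfolding gram_remove[OF S i] leverage_def
  by (rule mat_inv_minus_vec_square[OF gram_carrier[OF S] det transpose_reg_gram row_carrier v])
    (use S i h in \<open>auto simp: leverage_def\<close>)

lemma sum_one_minus_leverage:
  assumes S: "S \<subseteq> {..<n}" and det: "Determinant.det (gram S) \<noteq> 0"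
  shows "(\<Sum>i\<in>S. 1 - leverage S i) = card S - eff_dim (row_submatrix X S) l"
  using sum_row_submatrix[OF S, of "energy S"]
  by (simp add: eff_dim_eq_sum_rows[OF row_submatrix_carrier[OF S] det] sum_subtractf leverage_def)

text \<open>The diagonal entries of the inverse are energies of unit vectors, to which a removal
  adds nonnegative terms. So the trace of the inverse does not fall, and by
  \<open>eff_dim_eq_trace\<close> the effective dimension does not grow.\<close>

lemma eff_dim_remove_le:
  assumes S: "S \<subseteq> {..<n}" and i: "i \<in> S" and det: "Determinant.det (gram S) \<noteq> 0"
    and h: "leverage S i \<noteq> 1"
  shows "eff_dim (row_submatrix X (S - {i})) l \<le> eff_dim (row_submatrix X S) l"
proof -
  have S': "S - {i} \<subseteq> {..<n}" using S by auto
  have det': "Determinant.det (gram (S - {i})) \<noteq> 0"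
    using det_gram_remove[OF S i det] det h by simp
  note I = mat_inv_inverts(1)[OF gram_carrier[OF S] det]
    and I' = mat_inv_inverts(1)[OF gram_carrier[OF S'] det']
  have diag: "A $$ (j, j) = scalar_prod (unit_vec d j) (A *\<^sub>v unit_vec d j)"
    if "A \<in> carrier_mat d d" "j < d" for A :: "real Matrix.mat" and j
    using that by simp
  have "mat_inv (gram S) $$ (j, j) \<le> mat_inv (gram (S - {i})) $$ (j, j)" if j: "j < d" for j
    unfolding diag[OF I j] diag[OF I' j] energy_remove[OF S i det unit_vec_carrier h]
    using leverage_le_1[OF S i det] by simp
  hence "mat_trace (mat_inv (gram S)) \<le> mat_trace (mat_inv (gram (S - {i})))"
    unfolding mat_trace_def using I I' by (auto intro: sum_mono)
  hence "l * mat_trace (mat_inv (gram S)) \<le> l * mat_trace (mat_inv (gram (S - {i})))"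
    using l by (rule mult_left_mono)
  thus ?thesis
    by (simp add: eff_dim_eq_trace[OF row_submatrix_carrier[OF S] det]
        eff_dim_eq_trace[OF row_submatrix_carrier[OF S'] det'])
qed

section \<open>The removal distribution and the sets reached\<close>

lemma pmf_removal_pmf:
  assumes S: "S \<subseteq> {..<n}" and det: "Determinant.det (gram S) \<noteq> 0"
    and pos: "eff_dim (row_submatrix X S) l < card S"
  shows "pmf (removal_pmf X l S) i =
    (if i \<in> S then (1 - leverage S i) / (card S - eff_dim (row_submatrix X S) l) else 0)"
proof -
  let ?H = "card S - eff_dim (row_submatrix X S) l"
  let ?f = "\<lambda>i. if i \<in> S then (1 - leverage S i) / ?H else 0"
  have fin: "finite S" using S finite_subset by blast
  have nonneg: "0 \<le> ?f i" for i
    using leverage_le_1[OF S _ det, of i] pos by auto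
  have "removal_pmf X l S = embed_pmf ?f"
    unfolding removal_pmf_def
    by (rule arg_cong[of _ _ embed_pmf])
      (auto simp: removal_weight_eq[OF S _ det] sum_one_minus_leverage[OF S det])
  \<comment> \<open>\<open>embed_pmf\<close> is specified only for nonnegative functions of total
    mass 1. The numerators sum to \<open>?H\<close>, which \<open>pos\<close> makes
    positive.\<close>
  moreover have "(\<integral>\<^sup>+i. ennreal (?f i) \<partial>count_space UNIV) = 1"
  proof -
    have "(\<integral>\<^sup>+i. ennreal (?f i) \<partial>count_space UNIV) = (\<Sum>i\<in>S. ennreal (?f i))"
      by (rule nn_integral_count_space'[OF fin]) auto
    also have "\<dots> = ennreal (\<Sum>i\<in>S. ?f i)" using nonneg by (rule sum_ennreal)
    also have "(\<Sum>i\<in>S. ?f i) = (\<Sum>i\<in>S. 1 - leverage S i) / ?H"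
      by (simp add: sum_divide_distrib)
    also have "\<dots> = 1" using sum_one_minus_leverage[OF S det] pos by simp
    finally show ?thesis by simp
  qed
  ultimately show ?thesis using pmf_embed_pmf[of ?f, OF nonneg] by simp
qed

text \<open>A row of leverage 1 has probability zero, so the removals that would make the Gram
  matrix singular never happen.\<close>

lemma set_removal_pmf:
  assumes S: "S \<subseteq> {..<n}" and det: "Determinant.det (gram S) \<noteq> 0"
    and pos: "eff_dim (row_submatrix X S) l < card S"
    and i: "i \<in> set_pmf (removal_pmf X l S)"
  shows "i \<in> S" "leverage S i \<noteq> 1"
  using i by (auto simp: set_pmf_iff pmf_removal_pmf[OF S det pos] split: if_splits)

text \<open>The invariant of the run, with \<open>Suc k\<close> rounds left before the removal and
  \<open>k\<close> after it. While a round is left, it keeps the cardinality strictly above the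
  effective dimension, so the distribution of that round is well defined.\<close>

lemma removal_step:
  fixes D :: real
  assumes S: "S \<subseteq> {..<n}" and det: "Determinant.det (gram S) \<noteq> 0"
    and eff: "eff_dim (row_submatrix X S) l \<le> D" and D: "D + real (Suc k) \<le> card S"
    and i: "i \<in> set_pmf (removal_pmf X l S)"
  shows "S - {i} \<subseteq> {..<n}" "Determinant.det (gram (S - {i})) \<noteq> 0"
    "eff_dim (row_submatrix X (S - {i})) l \<le> D" "real (card (S - {i})) = real (card S) - 1"
    "D + real k \<le> card (S - {i})"
proof -
  have pos: "eff_dim (row_submatrix X S) l < card S" using eff D by simp
  note iS = set_removal_pmf[OF S det pos i]
  have fin: "finite S" using S finite_subset by blast
  show "S - {i} \<subseteq> {..<n}" using S by auto
  show "Determinant.det (gram (S - {i})) \<noteq> 0"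
    using det_gram_remove[OF S iS(1) det] det iS(2) by simp
  show "eff_dim (row_submatrix X (S - {i})) l \<le> D"
    using eff_dim_remove_le[OF S iS(1) det iS(2)] eff by simp
  have "card S = Suc (card (S - {i}))" using card.remove[OF fin iS(1)] .
  thus "real (card (S - {i})) = real (card S) - 1" "D + real k \<le> card (S - {i})"
    using D by auto
qed

lemma set_removal_rounds:
  fixes D :: real
  assumes "S \<subseteq> {..<n}" "Determinant.det (gram S) \<noteq> 0"
    and "eff_dim (row_submatrix X S) l \<le> D" "D + real k \<le> card S"
    and "T \<in> set_pmf (removal_rounds X l k S)"
  shows "T \<subseteq> {..<n} \<and> Determinant.det (gram T) \<noteq> 0"
  using assms
proof (induction k arbitrary: S)
  case (Suc k)
  then obtain i where i: "i \<in> set_pmf (removal_pmf X l S)"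
    and T: "T \<in> set_pmf (removal_rounds X l k (S - {i}))" by auto
  note step = removal_step[OF Suc.prems(1-4) i]
  show ?case by (rule Suc.IH[OF step(1,2,3,5) T])
qed auto

lemma finite_set_removal_rounds:
  fixes D :: real
  assumes "S \<subseteq> {..<n}" "Determinant.det (gram S) \<noteq> 0"
    and "eff_dim (row_submatrix X S) l \<le> D" "D + real k \<le> card S"
  shows "finite (set_pmf (removal_rounds X l k S))"
  by (rule finite_subset[of _ "Pow {..<n}"]) (use set_removal_rounds[OF assms] in auto)

section \<open>The expected energy along the run\<close>

lemma expected_energy_step:
  fixes D :: real
  assumes S: "S \<subseteq> {..<n}" and det: "Determinant.det (gram S) \<noteq> 0"
    and eff: "eff_dim (row_submatrix X S) l \<le> D" and D: "D < card S" and v: "v \<in> carrier_vec d"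
  shows "(\<Sum>i\<in>S. pmf (removal_pmf X l S) i * energy (S - {i}) v) \<le>
    (real (card S) - D + 1) / (real (card S) - D) * energy S v"
proof -
  define H where "H = card S - eff_dim (row_submatrix X S) l"
  let ?a = "\<lambda>i. scalar_prod (Matrix.row X i) (mat_inv (gram S) *\<^sub>v v)"
  have pos: "eff_dim (row_submatrix X S) l < card S" using eff D by simp
  have H: "H > 0" "real (card S) - D \<le> H" using eff pos by (simp_all add: H_def)
  have q: "0 \<le> energy S v" by (rule energy_nonneg[OF S det v])
  have "pmf (removal_pmf X l S) i * energy (S - {i}) v \<le>
      ((1 - leverage S i) * energy S v + (?a i)\<^sup>2) / H" if i: "i \<in> S" for i
  proof (cases "leverage S i = 1")
    case True
    \<comment> \<open>here \<open>energy (S - {i}) v\<close> involves the unspecified inverse of a singular matrix\<close>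
    thus ?thesis using H i by (simp add: pmf_removal_pmf[OF S det pos])
  next
    case False
    have "pmf (removal_pmf X l S) i = (1 - leverage S i) / H"
      using i by (simp add: pmf_removal_pmf[OF S det pos] H_def)
    thus ?thesis using False
      by (simp add: energy_remove[OF S i det v False] distrib_left add_divide_distrib)
  qed
  hence "(\<Sum>i\<in>S. pmf (removal_pmf X l S) i * energy (S - {i}) v) \<le>
      (\<Sum>i\<in>S. ((1 - leverage S i) * energy S v + (?a i)\<^sup>2) / H)"
    by (rule sum_mono)
  also have "\<dots> = ((\<Sum>i\<in>S. 1 - leverage S i) * energy S v + (\<Sum>i\<in>S. (?a i)\<^sup>2)) / H"
    by (simp only: sum_divide_distrib[symmetric] sum.distrib sum_distrib_right)
  \<comment> \<open>The weights sum to \<open>H\<close>, and the squared products to at most the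
    energy.\<close>
  also have "\<dots> \<le> (H * energy S v + energy S v) / H"
    using sum_row_products_squared_le_energy[OF S det v] H
    by (simp add: sum_one_minus_leverage[OF S det] H_def[symmetric] divide_right_mono)
  also have "\<dots> = (1 + 1 / H) * energy S v" using H by (simp add: field_simps)
  \<comment> \<open>\<open>H\<close> depends on the rows in \<open>S\<close>. Passing to the smaller
    card S - D leaves a factor that depends on the cardinality alone, as telescoping
    requires.\<close>
  also have "\<dots> \<le> (1 + 1 / (real (card S) - D)) * energy S v"
    using H D q by (intro mult_right_mono add_left_mono divide_left_mono) auto
  also have "1 + 1 / (real (card S) - D) = (real (card S) - D + 1) / (real (card S) - D)"
    using D by (simp add: field_simps)
  finally show ?thesis .
qed

text \<open>Induction on the rounds, peeling off the first removal. The denominator is at least 1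
  because D + k <= card S, even in the boundary case of equality.\<close>

lemma expected_energy_le:
  fixes D :: real
  assumes "S \<subseteq> {..<n}" "Determinant.det (gram S) \<noteq> 0"
    and "eff_dim (row_submatrix X S) l \<le> D" "D + real k \<le> card S" and v: "v \<in> carrier_vec d"
  shows "measure_pmf.expectation (removal_rounds X l k S) (\<lambda>T. energy T v) \<le>
    (real (card S) - D + 1) / (real (card S) - real k - D + 1) * energy S v"
  using assms(1-4)
proof (induction k arbitrary: S)
  case 0
  thus ?case by simp
next
  case (Suc k)
  note S = Suc.prems(1) and det = Suc.prems(2)
  note step = removal_step[OF Suc.prems]
  let ?p = "removal_pmf X l S"
  \<comment> \<open>The induction hypothesis gives this factor for \<open>k\<close> rounds from card
    S - 1 rows. Its numerator is the denominator of the one-round factor, so the two cancel.\<close>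
  define c where "c = (real (card S) - D) / (real (card S) - real (Suc k) - D + 1)"
  have fin: "finite S" using S finite_subset by blast
  have pos: "eff_dim (row_submatrix X S) l < card S" and D: "D < card S"
    using Suc.prems(3,4) by simp_all
  have c: "0 \<le> c" using Suc.prems(4) by (simp add: c_def)
  have sub: "set_pmf ?p \<subseteq> S" using set_removal_pmf(1)[OF S det pos] by auto
  have "measure_pmf.expectation (removal_rounds X l (Suc k) S) (\<lambda>T. energy T v) =
      (\<Sum>i\<in>set_pmf ?p. pmf ?p i *\<^sub>R
        measure_pmf.expectation (removal_rounds X l k (S - {i})) (\<lambda>T. energy T v))"
    unfolding removal_rounds.simps
    by (rule pmf_expectation_bind)
      (use finite_subset[OF sub fin] finite_set_removal_rounds[OF step(1,2,3,5)] in auto)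
  also have "\<dots> \<le> (\<Sum>i\<in>set_pmf ?p. pmf ?p i * (c * energy (S - {i}) v))"
  proof (rule sum_mono)
    fix i assume i: "i \<in> set_pmf ?p"
    have "measure_pmf.expectation (removal_rounds X l k (S - {i})) (\<lambda>T. energy T v) \<le>
        c * energy (S - {i}) v"
      using Suc.IH[OF step(1,2,3,5)[OF i]] step(4)[OF i] by (simp add: c_def algebra_simps)
    thus "pmf ?p i *\<^sub>R measure_pmf.expectation (removal_rounds X l k (S - {i})) (\<lambda>T. energy T v)
        \<le> pmf ?p i * (c * energy (S - {i}) v)"
      by (simp add: mult_left_mono)
  qed
  \<comment> \<open>Indices of \<open>S\<close> outside the support contribute 0, whatever value the
    unspecified inverse of a singular matrix gives there.\<close>
  also have "\<dots> = (\<Sum>i\<in>S. pmf ?p i * (c * energy (S - {i}) v))"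
    by (rule sum.mono_neutral_left[OF fin sub]) (auto simp: set_pmf_iff)
  also have "\<dots> = c * (\<Sum>i\<in>S. pmf ?p i * energy (S - {i}) v)"
    by (simp add: sum_distrib_left mult_ac)
  also have "\<dots> \<le> c * ((real (card S) - D + 1) / (real (card S) - D) * energy S v)"
    by (rule mult_left_mono[OF expected_energy_step[OF S det Suc.prems(3) D v] c])
  also have "\<dots> = (real (card S) - D + 1) / (real (card S) - real (Suc k) - D + 1) * energy S v"
    using D by (simp add: c_def)
  finally show ?case .
qed

end

section \<open>The Loewner bound\<close>

theorem theorem4p1:
  fixes X :: "real Matrix.mat" and n d s :: nat and l :: real
  assumes "X \<in> carrier_mat n d"
    and "l \<ge> 0"
    and "l = 0 \<Longrightarrow> vec_space.rank n X = d"
    and "s \<le> n"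
    and "real s \<ge> eff_dim X l"
  shows "mat_expectation d (volume_sampling X l s)
           (\<lambda>S. mat_inv (reg_gram (row_submatrix X S) l))
         \<preceq> ((real n - eff_dim X l + 1) / (real s - eff_dim X l + 1)) \<cdot>\<^sub>m
             mat_inv (reg_gram X l)"
proof -
  interpret regularized_rows X n d l
    by unfold_locales (use assms in auto)
  let ?p = "volume_sampling X l s" and ?c = "(real n - eff_dim X l + 1) / (real s - eff_dim X l + 1)"
  let ?E = "mat_expectation d ?p (\<lambda>S. mat_inv (gram S))"
  have p: "?p = removal_rounds X l (n - s) {..<n}"
    using X by (simp add: volume_sampling_def)
  have det: "Determinant.det (reg_gram X l) \<noteq> 0"
    by (rule det_reg_gram_nonzero[OF assms(1-3)])
  note G = reg_gram_carrier[OF X, of l]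
  note I = mat_inv_inverts(1)[OF G det]
  \<comment> \<open>The invariant at the full row set, with D the effective dimension of
    \<open>X\<close> and n - s rounds left. Its last condition, D + (n - s) <= n, is the assumed
    lower bound on \<open>s\<close>.\<close>
  have start: "{..<n} \<subseteq> {..<n}" "Determinant.det (gram {..<n}) \<noteq> 0"
    "eff_dim (row_submatrix X {..<n}) l \<le> eff_dim X l"
    "eff_dim X l + real (n - s) \<le> card {..<n}"
    using det assms(4,5) by (simp_all add: row_submatrix_all of_nat_diff)
  have reach: "T \<subseteq> {..<n}" "Determinant.det (gram T) \<noteq> 0" if "T \<in> set_pmf ?p" for T
    using set_removal_rounds[OF start] that unfolding p by auto
  have fin: "finite (set_pmf ?p)"
    using finite_set_removal_rounds[OF start] by (simp add: p)
  have inv_carrier: "mat_inv (gram T) \<in> carrier_mat d d" if "T \<in> set_pmf ?p" for T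
    using mat_inv_inverts(1)[OF gram_carrier] reach[OF that] by auto
  have E: "?E \<in> carrier_mat d d" by (simp add: mat_expectation_def)
  \<comment> \<open>\<open>psd\<close> includes symmetry. The inverses are known to be symmetric on
    the support only, so the expectations are compared almost everywhere.\<close>
  have Esym: "transpose_mat ?E = ?E"
  proof (rule eq_matI)
    fix i j assume "i < dim_row ?E" "j < dim_col ?E"
    hence ij: "i < d" "j < d" using E by auto
    have "mat_inv (gram T) $$ (j, i) = mat_inv (gram T) $$ (i, j)" if T: "T \<in> set_pmf ?p" for T
      using transpose_mat_inv[OF gram_carrier[OF reach(1)[OF T]] reach(2)[OF T] transpose_reg_gram]
        inv_carrier[OF T] ij by (metis carrier_matD index_transpose_mat(1))
    hence "measure_pmf.expectation ?p (\<lambda>T. mat_inv (gram T) $$ (j, i)) =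
        measure_pmf.expectation ?p (\<lambda>T. mat_inv (gram T) $$ (i, j))"
      by (intro integral_cong_AE) (auto simp: AE_measure_pmf_iff)
    thus "transpose_mat ?E $$ (i, j) = ?E $$ (i, j)"
      using ij by (simp add: mat_expectation_def)
  qed (use E in auto)
  let ?B = "?c \<cdot>\<^sub>m mat_inv (reg_gram X l)"
  have B: "?B \<in> carrier_mat d d" using I by simp
  have "transpose_mat ?B = ?B"
    using transpose_mat_inv[OF G det transpose_reg_gram] by (simp add: transpose_smult)
  hence sym: "transpose_mat (?B - ?E) = ?B - ?E"
    using Esym transpose_minus[OF B E] by simp
  have "0 \<le> scalar_prod v ((?B - ?E) *\<^sub>v v)" if v: "v \<in> carrier_vec d" for v
  proof -
    have "scalar_prod v (?E *\<^sub>v v) = measure_pmf.expectation ?p (\<lambda>T. energy T v)"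
      by (rule mat_expectation_quadratic[OF fin inv_carrier v])
    \<comment> \<open>For n rows and k = n - s rounds the denominator n - k - D + 1 is s - D +
      1.\<close>
    also have "\<dots> \<le> ?c * scalar_prod v (mat_inv (reg_gram X l) *\<^sub>v v)"
      using expected_energy_le[OF start v] assms(4) unfolding p
      by (simp add: row_submatrix_all of_nat_diff)
    finally show ?thesis
      using minus_mult_distrib_mat_vec[OF B E v] I E v
      by (simp add: scalar_prod_minus_distrib[of _ d] smult_mat_mult_vec[of _ d d])
  qed
  thus ?thesis
    unfolding loewner_le_def psd_def using sym B E by auto
qed

end
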